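(* Consider the monotonic cell transmission model with $n$ cells over the horizon $t\in\{0,\dots,T\}$, with given initial state $(\rho(0),q(0))$ and given external demands $w_k(t)$, $k\in\{0,\dots,n\}$. Let $(\rho,q,\phi,r)$ be a feasible trajectory of the minimal-TTS problem. Assume that along this trajectory every cell $k\in\{1,\dots,n\}$ is nonrestrictive at every time $t\in\{1,\dots,T-1\}$. Then this trajectory minimizes $$\mathrm{TTS}=\Delta t\cdot\sum_{t=0}^{T}\sum_{k=1}^{n}\bigl(l_k\rho_k(t)+q_k(t)\bigr)$$ over all feasible trajectories of the minimal-TTS problem (with the same initial state and the same external demands).
   Context: **Monotonic cell transmission model (CTM).** There are $n\ge 1$ cells, $k\in\{1,\dots,n\}$, with lengths $l_k>0$, split ratios $\beta_k\in[0,1)$, $\bar\beta_k:=1-\beta_k\in(0,1]$, a sampling time $\Delta t>0$, maximal metering rates $\bar r_k\ge 0$ and onramp capacities $\bar q_k\ge 0$ (a cell without onramp is modeled by $\bar r_k=\bar q_k=0$ and $w_k(t)=0$ for all $t$). Each cell has a jam density $\bar\rho_k$ and a critical density $\rho_k^c$, $0<\rho_k^c<\bar\rho_k$. The demand $d_k:[0,\bar\rho_k]\to\mathbb{R}_+$ is Lipschitz with constant $c_k^d$, nondecreasing, with $d_k(0)=0$ and $d_k(\rho_k^c)=d_k(\bar\rho_k)$. The supply $s_k:[0,\bar\rho_k]\to\mathbb{R}_+$ is Lipschitz with constant $c_k^s$, nonincreasing, with $s_k(\bar\rho_k)=0$ and $s_k(\rho_k^c)=s_k(0)$. Moreover $\Delta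 t\, c_k^d\le l_k\bar\beta_k$ and $\Delta t\, c_k^s\le l_k$ for all $k$. External demands satisfy $w_0(t)\ge 0$ and $0\le w_k(t)\le\bar r_k$ for $k\in\{1,\dots,n\}$. **Minimal-TTS problem.** A feasible trajectory consists of densities $\rho_k(t)$ and queues $q_k(t)$, $t\in\{0,\dots,T\}$, and flows $\phi_k(t)$ and metering rates $r_k(t)$, $t\in\{0,\dots,T-1\}$, with prescribed $\rho_k(0)$ and $q_k(0)$, satisfying for $k\in\{1,\dots,n\}$ - $\rho_k(t+1)=\rho_k(t)+\frac{\Delta t}{l_k}\bigl(\phi_{k-1}(t)+r_k(t)-\frac1{\bar\beta_k}\phi_k(t)\bigr)$, - $q_k(t+1)=q_k(t)+\Delta t\,(w_k(t)-r_k(t))$, - $\phi_0(t)=w_0(t)$; $\phi_k(t)=\min\{d_k(\rho_k(t)),s_{k+1}(\rho_{k+1}(t))\}$ for $1\le k\le n-1$; $\phi_n(t)=d_n(\rho_n(t))$, - $0\le r_k(t)\le\bar r_k$ for $t\in\{0,\dots,T-1\}$, and $0\le q_k(t)\le\bar q_k$ for $t\in\{0,\dots,T\}$, - $\rho_k(t)\in[0,\bar\rho_k]$ for $t\in\{0,\dots,T-1\}$, so that $d_k,s_k$ are evaluated in their domains. The problem is to minimize TTS over all feasible trajectories. **Capacities.** $F_k:=\min\{d_k(\rho_k^c),s_{k+1}(\rho_{k+1}^c)\}$ for $1\le k\le n-1$, and $F_n:=d_n(\rho_n^c)$. **Restrictive cells.** Cell $k$ is *restrictive* at time $t$ if (i)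 $k\ge 2$, $q_k(t)<\bar q_k$ and $s_k(\rho_k(t))=\phi_{k-1}(t)<F_{k-1}$; or (ii) $q_k(t)>0$ and $d_k(\rho_k(t))=\phi_k(t)<F_k$. Otherwise it is *nonrestrictive* at time $t$. (Condition (i) is void for $k=1$, because the inflow $\phi_0(t)=w_0(t)$ is never limited by supply.) *)

theory Defs
  imports "HOL-Analysis.Analysis"
begin

text \<open>
  Cells are numbered \<open>1, \<dots>, n\<close> and time steps are natural numbers. All families are total
  functions, but only their values at indices \<open>1 \<le> k \<le> n\<close> (index \<open>0\<close> is also used for the flow
  and the external demand) and at times within the horizon are constrained.
\<close>

record ctm =
  num_cells :: nat
  sampling_time :: real
  cell_length :: "nat \<Rightarrow> real"
  split_ratio :: "nat \<Rightarrow> real"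
  max_rate :: "nat \<Rightarrow> real"
  ramp_capacity :: "nat \<Rightarrow> real"
  jam_density :: "nat \<Rightarrow> real"
  crit_density :: "nat \<Rightarrow> real"
  demand_fn :: "nat \<Rightarrow> real \<Rightarrow> real"
  supply_fn :: "nat \<Rightarrow> real \<Rightarrow> real"
  demand_lipschitz :: "nat \<Rightarrow> real"
  supply_lipschitz :: "nat \<Rightarrow> real"

record trajectory =
  car_density :: "nat \<Rightarrow> nat \<Rightarrow> real"  \<comment> \<open>cell, time\<close>
  queue :: "nat \<Rightarrow> nat \<Rightarrow> real"
  flow :: "nat \<Rightarrow> nat \<Rightarrow> real"
  metering_rate :: "nat \<Rightarrow> nat \<Rightarrow> real"

definition cells :: "ctm \<Rightarrow> nat set" where
  "cells M = {1..num_cells M}"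

definition keep_ratio :: "ctm \<Rightarrow> nat \<Rightarrow> real" where
  "keep_ratio M k = 1 - split_ratio M k"

text \<open>
  A cell without onramp has \<open>max_rate M k = ramp_capacity M k = 0\<close>; its external demand is then
  zero by \<open>external_demands\<close> below.
\<close>

locale monotonic_ctm =
  fixes M :: ctm
  assumes num_cells_ge_1: "num_cells M \<ge> 1"
    and sampling_time_pos: "sampling_time M > 0"
    and cell_length_pos: "k \<in> cells M \<Longrightarrow> cell_length M k > 0"
    and split_ratio_range: "k \<in> cells M \<Longrightarrow> split_ratio M k \<in> {0..<1}"
    and max_rate_nonneg: "k \<in> cells M \<Longrightarrow> max_rate M k \<ge> 0"
    and ramp_capacity_nonneg: "k \<in> cells M \<Longrightarrow> ramp_capacity M k \<ge> 0"
    and crit_density_pos: "k \<in> cells M \<Longrightarrow> 0 < crit_density M k"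
    and crit_density_less_jam: "k \<in> cells M \<Longrightarrow> crit_density M k < jam_density M k"
    and demand_range: "k \<in> cells M \<Longrightarrow> demand_fn M k \<in> {0..jam_density M k} \<rightarrow> {0..}"
    and demand_lipschitz_on:
      "k \<in> cells M \<Longrightarrow> (demand_lipschitz M k)-lipschitz_on {0..jam_density M k} (demand_fn M k)"
    and demand_mono: "k \<in> cells M \<Longrightarrow> mono_on {0..jam_density M k} (demand_fn M k)"
    and demand_0: "k \<in> cells M \<Longrightarrow> demand_fn M k 0 = 0"
    and demand_crit:
      "k \<in> cells M \<Longrightarrow> demand_fn M k (crit_density M k) = demand_fn M k (jam_density M k)"
    and supply_range: "k \<in> cells M \<Longrightarrow> supply_fn M k \<in> {0..jam_density M k} \<rightarrow> {0..}"
    and supply_lipschitz_on: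
      "k \<in> cells M \<Longrightarrow> (supply_lipschitz M k)-lipschitz_on {0..jam_density M k} (supply_fn M k)"
    and supply_antimono: "k \<in> cells M \<Longrightarrow> antimono_on {0..jam_density M k} (supply_fn M k)"
    and supply_jam: "k \<in> cells M \<Longrightarrow> supply_fn M k (jam_density M k) = 0"
    and supply_crit: "k \<in> cells M \<Longrightarrow> supply_fn M k (crit_density M k) = supply_fn M k 0"
    and demand_cfl:
      "k \<in> cells M \<Longrightarrow> sampling_time M * demand_lipschitz M k \<le> cell_length M k * keep_ratio M k"
    and supply_cfl:
      "k \<in> cells M \<Longrightarrow> sampling_time M * supply_lipschitz M k \<le> cell_length M k"

definition external_demands :: "ctm \<Rightarrow> nat \<Rightarrow> (nat \<Rightarrow> nat \<Rightarrow> real) \<Rightarrow> bool" where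
  "external_demands M T w \<longleftrightarrow>
     (\<forall>t<T. 0 \<le> w 0 t \<and> (\<forall>k\<in>cells M. 0 \<le> w k t \<and> w k t \<le> max_rate M k))"

definition feasible ::
  "ctm \<Rightarrow> nat \<Rightarrow> (nat \<Rightarrow> nat \<Rightarrow> real) \<Rightarrow> (nat \<Rightarrow> real) \<Rightarrow> (nat \<Rightarrow> real) \<Rightarrow> trajectory \<Rightarrow> bool" where
  "feasible M T w \<rho>\<^sub>0 q\<^sub>0 X \<longleftrightarrow>
     (\<forall>k\<in>cells M. car_density X k 0 = \<rho>\<^sub>0 k \<and> queue X k 0 = q\<^sub>0 k) \<and>
     (\<forall>t<T. \<forall>k\<in>cells M.
        car_density X k (Suc t) = car_density X k t + sampling_time M / cell_length M k *
          (flow X (k - 1) t + metering_rate X k t - 1 / keep_ratio M k * flow X k t) \<and>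
        queue X k (Suc t) = queue X k t + sampling_time M * (w k t - metering_rate X k t)) \<and>
     (\<forall>t<T. flow X 0 t = w 0 t) \<and>
     (\<forall>t<T. \<forall>k\<in>{1..<num_cells M}.
        flow X k t = min (demand_fn M k (car_density X k t))
          (supply_fn M (k + 1) (car_density X (k + 1) t))) \<and>
     (\<forall>t<T. flow X (num_cells M) t =
        demand_fn M (num_cells M) (car_density X (num_cells M) t)) \<and>
     (\<forall>t<T. \<forall>k\<in>cells M. 0 \<le> metering_rate X k t \<and> metering_rate X k t \<le> max_rate M k) \<and>
     (\<forall>t\<le>T. \<forall>k\<in>cells M. 0 \<le> queue X k t \<and> queue X k t \<le> ramp_capacity M k) \<and>
     (\<forall>t<T. \<forall>k\<in>cells M. car_density X k t \<in> {0..jam_density M k})"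

text \<open>Only meaningful for \<open>k \<in> cells M\<close>.\<close>

definition flow_capacity :: "ctm \<Rightarrow> nat \<Rightarrow> real" where
  "flow_capacity M k =
     (if k = num_cells M then demand_fn M k (crit_density M k)
      else min (demand_fn M k (crit_density M k)) (supply_fn M (k + 1) (crit_density M (k + 1))))"

definition restrictive :: "ctm \<Rightarrow> trajectory \<Rightarrow> nat \<Rightarrow> nat \<Rightarrow> bool" where
  "restrictive M X k t \<longleftrightarrow>
     (k \<ge> 2 \<and> queue X k t < ramp_capacity M k \<and>
      supply_fn M k (car_density X k t) = flow X (k - 1) t \<and>
      flow X (k - 1) t < flow_capacity M (k - 1)) \<or>
     (queue X k t > 0 \<and>
      demand_fn M k (car_density X k t) = flow X k t \<and> flow X k t < flow_capacity M k)"

definition TTS :: "ctm \<Rightarrow> nat \<Rightarrow> trajectory \<Rightarrow> real" where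
  "TTS M T X =
     sampling_time M * (\<Sum>t=0..T. \<Sum>k\<in>cells M. (cell_length M k * car_density X k t + queue X k t))"

end

theory Submission
  imports Defs
begin

text \<open>
  Summing the conservation laws, TTS is a constant plus a nonincreasing function of the cumulative
  flows. It therefore suffices that the nonrestrictive trajectory maximizes the cumulative flow out
  of every cell at every time, which is shown by induction over time. A flow at capacity cannot be
  exceeded. A flow limited by the demand of its cell comes with an empty queue there, hence with a
  maximal cumulative inflow from the onramp; a flow limited by the supply of the next cell comes
  with a full queue there, hence with a minimal one. The comparison then propagates because the CFL
  conditions make the cumulative flow after a step a nondecreasing function of the current
  cumulative flows.
\<close>

section \<open>Cumulative flows and one-sided Lipschitz bounds\<close>

definition cum_flow :: "trajectory \<Rightarrow> nat \<Rightarrow> nat \<Rightarrow> real" where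
  "cum_flow X k t = (\<Sum>s<t. flow X k s)"

definition cum_rate :: "trajectory \<Rightarrow> nat \<Rightarrow> nat \<Rightarrow> real" where
  "cum_rate X k t = (\<Sum>s<t. metering_rate X k s)"

lemma cum_flow_Suc: "cum_flow X k (Suc t) = cum_flow X k t + flow X k t"
  by (simp add: cum_flow_def)

lemma cum_rate_Suc: "cum_rate X k (Suc t) = cum_rate X k t + metering_rate X k t"
  by (simp add: cum_rate_def)

text \<open>In the applications \<open>l\<close> is a cell length, \<open>h\<close> a sampling time,
  possibly scaled, and \<open>d\<close> the lead of one trajectory over another in cumulative flow.
  The condition \<open>c * h \<le> l\<close> then lets the flow function change by no more than that
  lead.\<close>

lemma lipschitz_cfl_le:
  fixes f :: "real \<Rightarrow> real"
  assumes "c-lipschitz_on S f" "x \<in> S" "y \<in> S"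
    and "0 < l" "0 \<le> d" "c * h \<le> l" "l * \<bar>y - x\<bar> \<le> h * d"
  shows "f y \<le> f x + d"
proof -
  have "0 \<le> c"
    using assms(1) by (rule lipschitz_on_nonneg)
  have "l * (c * \<bar>y - x\<bar>) = c * (l * \<bar>y - x\<bar>)"
    by simp
  also have "\<dots> \<le> c * (h * d)"
    using assms(7) \<open>0 \<le> c\<close> by (rule mult_left_mono)
  also have "\<dots> \<le> l * d"
    using mult_right_mono[OF assms(6,5)] by (simp add: mult.assoc)
  finally have "c * \<bar>y - x\<bar> \<le> d"
    using \<open>0 < l\<close> by simp
  moreover have "\<bar>f y - f x\<bar> \<le> c * \<bar>y - x\<bar>"
    using lipschitz_onD[OF assms(1,3,2)] by (simp add: dist_real_def)
  ultimately show ?thesis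
    by linarith
qed

text \<open>Monotonicity settles the case \<open>y \<le> x\<close>, so no absolute value is needed
  in the last hypothesis. This matters because comparing trajectories bounds the density difference
  in one direction only.\<close>

lemma mono_lipschitz_cfl_le:
  fixes f :: "real \<Rightarrow> real"
  assumes "c-lipschitz_on S f" "mono_on S f" "x \<in> S" "y \<in> S"
    and "0 < l" "0 \<le> d" "c * h \<le> l" "l * (y - x) \<le> h * d"
  shows "f y \<le> f x + d"
proof (cases "y \<le> x")
  case True
  then have "f y \<le> f x"
    using assms by (auto dest: mono_onD)
  then show ?thesis
    using \<open>0 \<le> d\<close> by linarith
next
  case False
  then show ?thesis
    using assms by (intro lipschitz_cfl_le[of c S f x y l d h]) auto
qed

lemma antimono_lipschitz_cfl_le:
  fixes f :: "real \<Rightarrow> real"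
  assumes "c-lipschitz_on S f" "antimono_on S f" "x \<in> S" "y \<in> S"
    and "0 < l" "0 \<le> d" "c * h \<le> l" "l * (x - y) \<le> h * d"
  shows "f y \<le> f x + d"
proof (cases "x \<le> y")
  case True
  then have "f y \<le> f x"
    using assms by (auto dest: monotone_onD)
  then show ?thesis
    using \<open>0 \<le> d\<close> by linarith
next
  case False
  then show ?thesis
    using assms by (intro lipschitz_cfl_le[of c S f x y l d h]) auto
qed

section \<open>Conservation laws and capacity bounds\<close>

context monotonic_ctm
begin

lemma keep_ratio_bounds:
  assumes "k \<in> cells M"
  shows "0 < keep_ratio M k" "keep_ratio M k \<le> 1"
  using split_ratio_range[OF assms] by (auto simp: keep_ratio_def)

text \<open>The demand at the critical density equals the demand at the jam density, where a
  nondecreasing function is maximal.\<close>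

lemma demand_le_crit:
  assumes "k \<in> cells M" "x \<in> {0..jam_density M k}"
  shows "demand_fn M k x \<le> demand_fn M k (crit_density M k)"
  using mono_onD[OF demand_mono[OF assms(1)], of x "jam_density M k"] demand_crit[OF assms(1)] assms
  by auto

lemma supply_le_crit:
  assumes "k \<in> cells M" "x \<in> {0..jam_density M k}"
  shows "supply_fn M k x \<le> supply_fn M k (crit_density M k)"
  using monotone_onD[OF supply_antimono[OF assms(1)], of 0 x] supply_crit[OF assms(1)] assms
  by auto

text \<open>In this cumulative form a trajectory enters only through its cumulative flows and rates;
  the initial term cancels when two trajectories are compared.\<close>

lemma scaled_density:
  assumes "feasible M T w \<rho>\<^sub>0 q\<^sub>0 X" "k \<in> cells M" "t \<le> T"
  shows "cell_length M k * car_density X k t = cell_length M k * \<rho>\<^sub>0 k + sampling_time M *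
    (cum_flow X (k - 1) t + cum_rate X k t - cum_flow X k t / keep_ratio M k)"
  using assms(3)
proof (induction t)
  case 0
  then show ?case
    using assms by (simp add: feasible_def cum_flow_def cum_rate_def)
next
  case (Suc t)
  have "car_density X k (Suc t) = car_density X k t + sampling_time M / cell_length M k *
      (flow X (k - 1) t + metering_rate X k t - 1 / keep_ratio M k * flow X k t)"
    using assms Suc.prems by (simp add: feasible_def)
  then have "cell_length M k * car_density X k (Suc t) = cell_length M k * car_density X k t +
      sampling_time M * (flow X (k - 1) t + metering_rate X k t - flow X k t / keep_ratio M k)"
    using cell_length_pos[OF assms(2)] by (simp add: distrib_left)
  then show ?case
    using Suc by (simp add: cum_flow_Suc cum_rate_Suc algebra_simps add_divide_distrib)
qed

lemma queue_eq:
  assumes "feasible M T w \<rho>\<^sub>0 q\<^sub>0 X" "k \<in> cells M" "t \<le> T"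
  shows "queue X k t = q\<^sub>0 k + sampling_time M * ((\<Sum>s<t. w k s) - cum_rate X k t)"
  using assms(3)
proof (induction t)
  case 0
  then show ?case
    using assms by (simp add: feasible_def cum_rate_def)
next
  case (Suc t)
  have "queue X k (Suc t) = queue X k t + sampling_time M * (w k t - metering_rate X k t)"
    using assms Suc.prems by (simp add: feasible_def)
  then show ?case
    using Suc by (simp add: cum_rate_Suc algebra_simps)
qed

text \<open>Initial queue and external demand are shared, so a shorter queue means that more cars
  were released. An empty or a full queue thus gives an extremal cumulative rate.\<close>

lemma cum_rate_le_iff_queue:
  assumes "feasible M T w \<rho>\<^sub>0 q\<^sub>0 X" "feasible M T w \<rho>\<^sub>0 q\<^sub>0 Y" "k \<in> cells M" "t \<le> T"
  shows "cum_rate Y k t \<le> cum_rate X k t \<longleftrightarrow> queue X k t \<le> queue Y k t"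
  using queue_eq[OF assms(1,3,4)] queue_eq[OF assms(2,3,4)] sampling_time_pos
  by simp

lemma flow_le_capacity:
  assumes "feasible M T w \<rho>\<^sub>0 q\<^sub>0 X" "k \<in> cells M" "t < T"
  shows "flow X k t \<le> flow_capacity M k"
proof -
  have *: "car_density X j t \<in> {0..jam_density M j}" if "j \<in> cells M" for j
    using assms that by (simp add: feasible_def)
  show ?thesis
  proof (cases "k = num_cells M")
    case True
    then have "flow X k t = demand_fn M k (car_density X k t)"
      using assms by (simp add: feasible_def)
    then show ?thesis
      using True demand_le_crit[OF assms(2) *[OF assms(2)]] by (simp add: flow_capacity_def)
  next
    case False
    then have k: "k \<in> {1..<num_cells M}" and k': "k + 1 \<in> cells M"
      using assms(2) by (auto simp: cells_def)
    then have "flow X k t = min (demand_fn M k (car_density X k t))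
        (supply_fn M (k + 1) (car_density X (k + 1) t))"
      using assms by (simp add: feasible_def)
    then show ?thesis
      using False demand_le_crit[OF assms(2) *[OF assms(2)]] supply_le_crit[OF k' *[OF k']]
      by (auto simp: flow_capacity_def min_def)
  qed
qed

section \<open>One-step comparison of cumulative flows\<close>

lemma flow_le_demand:
  assumes "feasible M T w \<rho>\<^sub>0 q\<^sub>0 X" "k \<in> cells M" "t < T"
  shows "flow X k t \<le> demand_fn M k (car_density X k t)"
  using assms by (cases "k = num_cells M") (auto simp: feasible_def cells_def)

lemma flow_le_supply:
  assumes "feasible M T w \<rho>\<^sub>0 q\<^sub>0 X" "k \<in> {1..<num_cells M}" "t < T"
  shows "flow X k t \<le> supply_fn M (k + 1) (car_density X (k + 1) t)"
  using assms by (simp add: feasible_def)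

lemma flow_cases:
  assumes "feasible M T w \<rho>\<^sub>0 q\<^sub>0 X" "k \<in> cells M" "t < T"
  obtains "flow X k t = demand_fn M k (car_density X k t)"
  | "k \<in> {1..<num_cells M}"
      "flow X k t = supply_fn M (k + 1) (car_density X (k + 1) t)"
proof (cases "k = num_cells M")
  case True
  then show thesis
    using that(1) assms by (simp add: feasible_def)
next
  case False
  then have k: "k \<in> {1..<num_cells M}"
    using assms(2) by (auto simp: cells_def)
  then have "flow X k t = min (demand_fn M k (car_density X k t))
      (supply_fn M (k + 1) (car_density X (k + 1) t))"
    using assms by (simp add: feasible_def)
  then show thesis
    using that k unfolding min_def by metis
qed

text \<open>Having let more cars out, \<open>X\<close> may have a lower density in cell
  \<open>k\<close> and so a lower demand, but the CFL condition bounds this loss by the lead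
  \<open>?d\<close>.\<close>

lemma cum_flow_step_demand:
  assumes X: "feasible M T w \<rho>\<^sub>0 q\<^sub>0 X" and Y: "feasible M T w \<rho>\<^sub>0 q\<^sub>0 Y"
    and k: "k \<in> cells M" and t: "t < T"
    and flow: "flow X k t = demand_fn M k (car_density X k t)"
    and rate: "cum_rate Y k t \<le> cum_rate X k t"
    and le: "cum_flow Y (k - 1) t \<le> cum_flow X (k - 1) t" "cum_flow Y k t \<le> cum_flow X k t"
  shows "cum_flow Y k (Suc t) \<le> cum_flow X k (Suc t)"
proof -
  let ?d = "cum_flow X k t - cum_flow Y k t" and ?b = "keep_ratio M k"
  have "cell_length M k * (car_density Y k t - car_density X k t) =
      sampling_time M * ((cum_flow Y (k - 1) t - cum_flow X (k - 1) t) +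
        (cum_rate Y k t - cum_rate X k t) + ?d / ?b)"
    using scaled_density[OF X k, of t] scaled_density[OF Y k, of t] t
    by (simp add: algebra_simps diff_divide_distrib)
  also have "\<dots> \<le> sampling_time M * (?d / ?b)"
    using rate le(1) sampling_time_pos by (intro mult_left_mono) auto
  finally have "cell_length M k * (car_density Y k t - car_density X k t)
      \<le> sampling_time M / ?b * ?d"
    by simp
  \<comment> \<open>Cars leaving by the offramp inflate the lead to \<open>?d / ?b\<close>. The
    factor \<open>keep_ratio M k\<close> in the demand CFL condition compensates for exactly
    this.\<close>
  moreover have "demand_lipschitz M k * (sampling_time M / ?b) \<le> cell_length M k"
    using demand_cfl[OF k] keep_ratio_bounds[OF k] by (simp add: field_simps)
  moreover have "car_density X k t \<in> {0..jam_density M k}" "car_density Y k t \<in> {0..jam_density M k}"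
    using X Y k t by (simp_all add: feasible_def)
  ultimately have
    "demand_fn M k (car_density Y k t) \<le> demand_fn M k (car_density X k t) + ?d"
    using cell_length_pos[OF k] le(2)
    by (intro mono_lipschitz_cfl_le[OF demand_lipschitz_on[OF k] demand_mono[OF k],
          where l = "cell_length M k" and h = "sampling_time M / ?b"]) simp_all
  \<comment> \<open>The flow of \<open>Y\<close> is at most its demand whichever term limits it, so
    only \<open>X\<close> has to be demand-limited.\<close>
  then show ?thesis
    using flow_le_demand[OF Y k t] flow by (simp add: cum_flow_Suc)
qed

text \<open>The lead of \<open>X\<close> out of cell \<open>k\<close> fills cell
  \<open>k + 1\<close> and can lower its supply, by at most that lead. Smaller onramp inflow and
  larger outflow only reduce the density of \<open>X\<close> there, hence the reversed hypothesis on
  the rates.\<close>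

lemma cum_flow_step_supply:
  assumes X: "feasible M T w \<rho>\<^sub>0 q\<^sub>0 X" and Y: "feasible M T w \<rho>\<^sub>0 q\<^sub>0 Y"
    and k: "k \<in> {1..<num_cells M}" and t: "t < T"
    and flow: "flow X k t = supply_fn M (k + 1) (car_density X (k + 1) t)"
    and rate: "cum_rate X (k + 1) t \<le> cum_rate Y (k + 1) t"
    and le: "cum_flow Y k t \<le> cum_flow X k t" "cum_flow Y (k + 1) t \<le> cum_flow X (k + 1) t"
  shows "cum_flow Y k (Suc t) \<le> cum_flow X k (Suc t)"
proof -
  let ?d = "cum_flow X k t - cum_flow Y k t" and ?b = "keep_ratio M (k + 1)"
  have k': "k + 1 \<in> cells M"
    using k by (simp add: cells_def)
  have "cell_length M (k + 1) * (car_density X (k + 1) t - car_density Y (k + 1) t) =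
      sampling_time M * (?d + (cum_rate X (k + 1) t - cum_rate Y (k + 1) t) -
        (cum_flow X (k + 1) t - cum_flow Y (k + 1) t) / ?b)"
    using scaled_density[OF X k', of t] scaled_density[OF Y k', of t] t
    by (simp add: algebra_simps diff_divide_distrib)
  also have "\<dots> \<le> sampling_time M * ?d"
  proof -
    have "0 \<le> (cum_flow X (k + 1) t - cum_flow Y (k + 1) t) / ?b"
      using le(2) keep_ratio_bounds[OF k'] by simp
    then show ?thesis
      using rate sampling_time_pos by (intro mult_left_mono) auto
  qed
  finally have "cell_length M (k + 1) * (car_density X (k + 1) t - car_density Y (k + 1) t)
      \<le> sampling_time M * ?d" .
  moreover have "supply_lipschitz M (k + 1) * sampling_time M \<le> cell_length M (k + 1)"
    using supply_cfl[OF k'] by (simp add: mult.commute)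
  moreover have "car_density X (k + 1) t \<in> {0..jam_density M (k + 1)}"
    "car_density Y (k + 1) t \<in> {0..jam_density M (k + 1)}"
    using X Y k' t by (simp_all add: feasible_def)
  ultimately have "supply_fn M (k + 1) (car_density Y (k + 1) t)
      \<le> supply_fn M (k + 1) (car_density X (k + 1) t) + ?d"
    using cell_length_pos[OF k'] le(1)
    by (intro antimono_lipschitz_cfl_le[OF supply_lipschitz_on[OF k'] supply_antimono[OF k'],
          where l = "cell_length M (k + 1)" and h = "sampling_time M"]) simp_all
  then show ?thesis
    using flow_le_supply[OF Y k t] flow by (simp add: cum_flow_Suc)
qed

section \<open>Maximality of the cumulative flows and optimality\<close>

lemma cum_flow_0_eq:
  assumes "feasible M T w \<rho>\<^sub>0 q\<^sub>0 X" "feasible M T w \<rho>\<^sub>0 q\<^sub>0 Y" "t \<le> T"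
  shows "cum_flow X 0 t = cum_flow Y 0 t"
  using assms by (auto simp: feasible_def cum_flow_def intro!: sum.cong)

lemma nonrestrictive_cum_flow_maximal:
  assumes X: "feasible M T w \<rho>\<^sub>0 q\<^sub>0 X" and Y: "feasible M T w \<rho>\<^sub>0 q\<^sub>0 Y"
    and nonrestrictive: "\<And>k t. k \<in> cells M \<Longrightarrow> t \<in> {1..<T} \<Longrightarrow> \<not> restrictive M X k t"
    and "t \<le> T" "k \<le> num_cells M"
  shows "cum_flow Y k t \<le> cum_flow X k t"
  using assms(4,5)
\<comment> \<open>The cell stays arbitrary because the step for \<open>k\<close> uses the comparison
  at \<open>k - 1\<close> or at \<open>k + 1\<close>.\<close>
proof (induction t arbitrary: k)
  case 0
  then show ?case
    by (simp add: cum_flow_def)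
next
  case (Suc t)
  then have t: "t < T" and IH: "\<And>j. j \<le> num_cells M \<Longrightarrow> cum_flow Y j t \<le> cum_flow X j t"
    by simp_all
  show ?case
  \<comment> \<open>Index 0 is the prescribed inflow, for which \<open>flow_capacity\<close> has no
    meaning.\<close>
  proof (cases "k = 0 \<or> flow_capacity M k \<le> flow X k t")
    case True
    then show ?thesis
      using cum_flow_0_eq[OF X Y Suc.prems(1)] flow_le_capacity[OF Y _ t, of k]
        IH[of k] Suc.prems(2)
      by (cases "k = 0") (auto simp: cells_def cum_flow_Suc)
  next
    case False
    then have k: "k \<in> cells M" and lt: "flow X k t < flow_capacity M k"
      using Suc.prems by (simp_all add: cells_def)
    have queue: "0 \<le> queue Y j t" "queue Y j t \<le> ramp_capacity M j" if "j \<in> cells M" for j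
      using Y t that by (simp_all add: feasible_def)
    show ?thesis
      using X k t
    proof (cases rule: flow_cases)
      case 1
      have "cum_rate Y k t \<le> cum_rate X k t"
      \<comment> \<open>Nothing is assumed about restrictive cells at time 0, but there both
        cumulative rates are empty sums.\<close>
      proof (cases "t = 0")
        case False
        then have "queue X k t \<le> 0"
          using nonrestrictive[OF k, of t] t 1 lt by (auto simp: restrictive_def)
        then show ?thesis
          using cum_rate_le_iff_queue[OF X Y k, of t] queue[OF k] t by linarith
      qed (simp add: cum_rate_def)
      then show ?thesis
        using cum_flow_step_demand[OF X Y k t 1] IH Suc.prems(2) by simp
    next
      case 2
      then have k': "k + 1 \<in> cells M"
        by (simp add: cells_def)
      have "cum_rate X (k + 1) t \<le> cum_rate Y (k + 1) t"
      proof (cases "t = 0")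
        case False
        \<comment> \<open>The first clause of \<open>restrictive\<close> is applied to the
          downstream cell: \<open>k + 1\<close> is at least 2 and its inflow is the flow out of
          \<open>k\<close>.\<close>
        then have "ramp_capacity M (k + 1) \<le> queue X (k + 1) t"
          using nonrestrictive[OF k', of t] t 2 lt by (auto simp: restrictive_def)
        then show ?thesis
          using cum_rate_le_iff_queue[OF Y X k', of t] queue[OF k'] t by linarith
      qed (simp add: cum_rate_def)
      then show ?thesis
        using cum_flow_step_supply[OF X Y 2(1) t 2(2)] IH 2(1) by simp
    qed
  qed
qed

text \<open>The inequality already holds for the number of cars at each time. The metering rates
  cancel, since metering only moves cars from a queue into its cell.\<close>

lemma TTS_antimono_cum_flow:
  assumes X: "feasible M T w \<rho>\<^sub>0 q\<^sub>0 X" and Y: "feasible M T w \<rho>\<^sub>0 q\<^sub>0 Y"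
    and le: "\<And>k t. t \<le> T \<Longrightarrow> k \<le> num_cells M \<Longrightarrow> cum_flow Y k t \<le> cum_flow X k t"
  shows "TTS M T X \<le> TTS M T Y"
proof -
  have "(\<Sum>k\<in>cells M. cell_length M k * car_density X k t + queue X k t)
      \<le> (\<Sum>k\<in>cells M. cell_length M k * car_density Y k t + queue Y k t)" if "t \<le> T" for t
  proof -
    define D where "D k = cum_flow X k t - cum_flow Y k t" for k
    have "(\<Sum>k\<in>cells M. cell_length M k * car_density X k t + queue X k t)
        - (\<Sum>k\<in>cells M. cell_length M k * car_density Y k t + queue Y k t)
        = (\<Sum>k\<in>cells M. sampling_time M * (D (k - 1) - D k / keep_ratio M k))"
      unfolding sum_subtractf[symmetric] D_def
      using that
      by (intro sum.cong refl)
        (simp add: scaled_density[OF X] scaled_density[OF Y] queue_eq[OF X] queue_eq[OF Y]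
          algebra_simps diff_divide_distrib)
    \<comment> \<open>Discarding the additional offramp exits makes the sum telescope. What remains
      is \<open>D 0\<close>, which vanishes because the inflow is shared, minus the nonnegative lead
      at the last cell.\<close>
    also have "\<dots> \<le> (\<Sum>k\<in>cells M. sampling_time M * (D (k - 1) - D k))"
    proof (intro sum_mono mult_left_mono diff_left_mono)
      fix k
      assume k: "k \<in> cells M"
      then have "0 \<le> D k"
        using le[OF that, of k] by (simp add: D_def cells_def)
      then show "D k \<le> D k / keep_ratio M k"
        using keep_ratio_bounds[OF k] by (simp add: pos_le_divide_eq mult_left_le)
    qed (use sampling_time_pos in simp)
    also have "\<dots> = sampling_time M * (D 0 - D (num_cells M))"
      using sum_telescope''[of 0 "num_cells M" "\<lambda>k. - D k"]
      by (simp add: sum_distrib_left[symmetric] cells_def atLeastSucAtMost_greaterThanAtMost[symmetric])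
    also have "\<dots> \<le> 0"
      using cum_flow_0_eq[OF X Y that] le[OF that, of "num_cells M"] sampling_time_pos
      by (simp add: D_def mult_le_0_iff)
    finally show ?thesis
      by simp
  qed
  then show ?thesis
    unfolding TTS_def using sampling_time_pos
    by (intro mult_left_mono sum_mono[of "{0..T}"]) auto
qed

end

theorem theorem1:
  fixes M :: ctm and T :: nat and w :: "nat \<Rightarrow> nat \<Rightarrow> real"
    and \<rho>\<^sub>0 q\<^sub>0 :: "nat \<Rightarrow> real" and X :: trajectory
  assumes "monotonic_ctm M"
    and "external_demands M T w"
    and "feasible M T w \<rho>\<^sub>0 q\<^sub>0 X"
    and "\<And>k t. k \<in> cells M \<Longrightarrow> t \<in> {1..<T} \<Longrightarrow> \<not> restrictive M X k t"
  shows "is_arg_min (TTS M T) (feasible M T w \<rho>\<^sub>0 q\<^sub>0) X"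
proof -
  interpret monotonic_ctm M
    by (rule assms(1))
  have "TTS M T X \<le> TTS M T Y" if "feasible M T w \<rho>\<^sub>0 q\<^sub>0 Y" for Y
    using TTS_antimono_cum_flow[OF assms(3) that]
      nonrestrictive_cum_flow_maximal[OF assms(3) that assms(4)] by blast
  then show ?thesis
    using assms(3) by (simp add: is_arg_min_linorder)
qed

end
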